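(* Let $L$ be the squared loss, let $\eta>0$, suppose $(h_k(x)-y)^2\le M$ for all $k\in\{1,\dots,p\}$ and all $(x,y)\in\mathcal{X}\times\mathcal{Y}$, and suppose $\mathscr{D}_1,\dots,\mathscr{D}_p$ share a common conditional distribution of the label given the input. Then for any $k\in\{1,\dots,p\}$ and all $z\in\Delta$, $$\mathcal{L}(\mathscr{D}_k,h_z^\eta)-\mathcal{L}(\mathscr{D}_z,h_z^\eta)=u_k(z)-v_k(z),$$ where $u_k$ and $v_k$ are the functions of $z\in\Delta$ defined by $$u_k(z)=\mathcal{L}\big(\mathscr{D}_k+\eta\,\mathscr{U}^1\mathscr{D}_k(\cdot|x),\,h_z^\eta\big)-2M\sum_{x\in\mathcal{X}}\big(\mathscr{D}_k^1(x)+\eta\,\mathscr{U}^1(x)\big)\log K_z(x),$$ $$v_k(z)=\mathcal{L}\big(\mathscr{D}_z+\eta\,\mathscr{U}^1\mathscr{D}_k(\cdot|x),\,h_z^\eta\big)-2M\sum_{x\in\mathcal{X}}\big(\mathscr{D}_k^1(x)+\eta\,\mathscr{U}^1(x)\big)\log K_z(x),$$ and both $u_k$ and $v_k$ are convex functions of $z$.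
   Context: Setting: $\mathcal{X}$ is a nonempty finite set (input space); $\mathcal{Y}\subseteq\mathbb{R}$ is a nonempty convex set (output space); all probability distributions on $\mathcal{X}\times\mathcal{Y}$ and all conditional distributions on $\mathcal{Y}$ are finitely supported, so all sums over $\mathcal{Y}$ are finite sums. $\mathscr{U}^1$ is the uniform distribution on $\mathcal{X}$. The squared loss is $L(y',y)=(y'-y)^2$. For a finite nonnegative (not necessarily normalized) measure $\mu$ on $\mathcal{X}\times\mathcal{Y}$ with finite support and $h:\mathcal{X}\to\mathcal{Y}$, $\mathcal{L}(\mu,h)=\sum_{(x,y)}\mu(x,y)(h(x)-y)^2$. For a distribution $\mathscr{D}$ on $\mathcal{X}\times\mathcal{Y}$, $\mathscr{D}^1(x)=\sum_y\mathscr{D}(x,y)$ is the marginal on $\mathcal{X}$. There are $p\ge1$ source distributions $\mathscr{D}_1,\dots,\mathscr{D}_p$ on $\mathcal{X}\times\mathcal{Y}$ and predictors $h_k:\mathcal{X}\to\mathcal{Y}$. "Common conditional distribution" means: for every $x\in\mathcal{X}$ there is a probability distribution $\mathscr{D}(\cdot|x)$ on $\mathcal{Y}$, independent of $k$, with $\mathscr{D}_k(x,y)=\mathscr{D}_k^1(x)\mathscr{D}(y|x)$ for all $k,x,y$; one writes $\mathscr{D}_k(y|x)=\mathscr{D}(y|x)$. The measure $\mathscr{U}^1\mathscr{D}_k(\cdot|x)$ is $(x,y)\mapsto\mathscr{U}^1(x)\mathscr{D}_k(y|x)$. $\Delta=\{\lambda\in\mathbb{R}^p:\lambda_k\ge0\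 \forall k,\ \sum_k\lambda_k=1\}$. For $z\in\Delta$: $\mathscr{D}_z=\sum_{k=1}^pz_k\mathscr{D}_k$, $K_z(x)=\mathscr{D}_z^1(x)+\eta\,\mathscr{U}^1(x)$, and $$h_z^\eta(x)=\sum_{k=1}^p\frac{z_k\mathscr{D}_k^1(x)+\eta\,\mathscr{U}^1(x)/p}{K_z(x)}\,h_k(x).$$ *)

theory Defs
  imports "HOL-Probability.Probability_Mass_Function"
begin

text \<open>
  The input space is the universe of a finite type \<open>'x\<close>, the output space is a set \<open>Y\<close> of reals,
  and the sources are indexed by a finite type \<open>'p\<close>, so that mixture weights form the real vector
  space \<open>real ^ 'p\<close>. Probability distributions are PMFs; the finitely supported measures built from
  them, which need not be normalized, are represented by their point masses. Every sum over \<open>Y\<close>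
  ranges over the support of a measure, because Isabelle's \<open>sum\<close> is \<open>0\<close> on an infinite set.
\<close>

definition finite_dist_on :: "'a set \<Rightarrow> 'a pmf \<Rightarrow> bool" where
  "finite_dist_on A P \<longleftrightarrow> finite (set_pmf P) \<and> set_pmf P \<subseteq> A"

definition unif :: "'x::finite pmf" where
  "unif = pmf_of_set UNIV"

definition squared_loss :: "real \<Rightarrow> real \<Rightarrow> real" where
  "squared_loss y' y = (y' - y)\<^sup>2"

definition expected_loss :: "('x \<times> real \<Rightarrow> real) \<Rightarrow> ('x \<Rightarrow> real) \<Rightarrow> real" where
  "expected_loss \<mu> h = (\<Sum>(x, y) | \<mu> (x, y) \<noteq> 0. \<mu> (x, y) * squared_loss (h x) y)"

definition marginal :: "('x \<times> real \<Rightarrow> real) \<Rightarrow> 'x \<Rightarrow> real" where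
  "marginal \<mu> x = (\<Sum>y | \<mu> (x, y) \<noteq> 0. \<mu> (x, y))"

text \<open>
  The kernel \<open>C\<close> is explicit because the functions \<open>u_fun\<close> and \<open>v_fun\<close> below also use its values at
  inputs that have probability zero under some or all sources, where the sources do not determine it.
\<close>

definition common_conditional ::
    "real set \<Rightarrow> ('p \<Rightarrow> ('x \<times> real) pmf) \<Rightarrow> ('x \<Rightarrow> real pmf) \<Rightarrow> bool" where
  "common_conditional Y D C \<longleftrightarrow>
     (\<forall>x. finite_dist_on Y (C x)) \<and>
     (\<forall>k x y. pmf (D k) (x, y) = marginal (pmf (D k)) x * pmf (C x) y)"

definition prob_simplex :: "(real ^ 'p::finite) set" where
  "prob_simplex = {z. (\<forall>k. 0 \<le> z $ k) \<and> (\<Sum>k\<in>UNIV. z $ k) = 1}"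

definition mixture :: "('p::finite \<Rightarrow> ('x \<times> real) pmf) \<Rightarrow> real ^ 'p \<Rightarrow> 'x \<times> real \<Rightarrow> real" where
  "mixture D z q = (\<Sum>k\<in>UNIV. z $ k * pmf (D k) q)"

definition K_fun ::
    "('p::finite \<Rightarrow> ('x::finite \<times> real) pmf) \<Rightarrow> real \<Rightarrow> real ^ 'p \<Rightarrow> 'x \<Rightarrow> real" where
  "K_fun D \<eta> z x = marginal (mixture D z) x + \<eta> * pmf unif x"

definition h_comb ::
    "('p::finite \<Rightarrow> ('x::finite \<times> real) pmf) \<Rightarrow> ('p \<Rightarrow> 'x \<Rightarrow> real) \<Rightarrow> real \<Rightarrow> real ^ 'p \<Rightarrow> 'x \<Rightarrow> real"
  where
  "h_comb D h \<eta> z x =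
     (\<Sum>k\<in>UNIV. (z $ k * marginal (pmf (D k)) x + \<eta> * pmf unif x / real CARD('p))
        / K_fun D \<eta> z x * h k x)"

definition unif_cond :: "('x::finite \<Rightarrow> real pmf) \<Rightarrow> 'x \<times> real \<Rightarrow> real" where
  "unif_cond C = (\<lambda>(x, y). pmf unif x * pmf (C x) y)"

definition u_fun ::
    "('p::finite \<Rightarrow> ('x::finite \<times> real) pmf) \<Rightarrow> ('x \<Rightarrow> real pmf) \<Rightarrow> ('p \<Rightarrow> 'x \<Rightarrow> real) \<Rightarrow>
     real \<Rightarrow> real \<Rightarrow> 'p \<Rightarrow> real ^ 'p \<Rightarrow> real" where
  "u_fun D C h \<eta> M k z =
     expected_loss (\<lambda>q. pmf (D k) q + \<eta> * unif_cond C q) (h_comb D h \<eta> z)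
     - 2 * M * (\<Sum>x\<in>UNIV. (marginal (pmf (D k)) x + \<eta> * pmf unif x) * ln (K_fun D \<eta> z x))"

definition v_fun ::
    "('p::finite \<Rightarrow> ('x::finite \<times> real) pmf) \<Rightarrow> ('x \<Rightarrow> real pmf) \<Rightarrow> ('p \<Rightarrow> 'x \<Rightarrow> real) \<Rightarrow>
     real \<Rightarrow> real \<Rightarrow> 'p \<Rightarrow> real ^ 'p \<Rightarrow> real" where
  "v_fun D C h \<eta> M k z =
     expected_loss (\<lambda>q. mixture D z q + \<eta> * unif_cond C q) (h_comb D h \<eta> z)
     - 2 * M * (\<Sum>x\<in>UNIV. (marginal (pmf (D k)) x + \<eta> * pmf unif x) * ln (K_fun D \<eta> z x))"

end

theory Submission
  imports Defs
begin

text \<open>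
  For a fixed label \<open>y\<close>, write \<open>K\<close> for the denominator of the combined prediction at \<open>x\<close> and \<open>A\<close> for
  its numerator minus \<open>y K\<close>; both are affine in \<open>z\<close>, and by convexity of the weights
  \<open>\<bar>A\<bar> \<le> sqrt M * K\<close>. With a common conditional, \<open>v\<close> is a nonnegative combination of the functions
  \<open>A\<^sup>2 / K\<close> (quadratic over linear) and \<open>- ln K\<close>, while \<open>u\<close> is a nonnegative combination of the
  functions \<open>(A / K)\<^sup>2 - 2 M ln K\<close>. The squared ratio alone is not convex. With \<open>r = A / K\<close> and
  \<open>c = K' / K\<close>, its second derivative along a line is \<open>2 r'\<^sup>2 - 4 r r' c\<close>, the logarithm contributes
  \<open>2 M c\<^sup>2\<close>, and since \<open>r\<^sup>2 \<le> M\<close> the sum is at least \<open>2 (r' - r c)\<^sup>2\<close>.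
\<close>

section \<open>Convex functions\<close>

text \<open>An affine map preserves convex combinations. This pulls convexity of a function of the
  pair (numerator, denominator) back to the weight vector \<open>z\<close>.\<close>

lemma convex_on_compose_affine:
  assumes "linear f" "convex_on T F" "convex S" "\<And>x. x \<in> S \<Longrightarrow> c + f x \<in> T"
  shows "convex_on S (\<lambda>x. F (c + f x))"
proof (rule convex_onI)
  fix t :: real and x y
  assume t: "0 < t" "t < 1" and xy: "x \<in> S" "y \<in> S"
  have "c + f ((1 - t) *\<^sub>R x + t *\<^sub>R y) = (1 - t) *\<^sub>R (c + f x) + t *\<^sub>R (c + f y)"
    by (simp only: linear_add[OF assms(1)] linear_scale[OF assms(1)]) (simp add: algebra_simps)
  then show "F (c + f ((1 - t) *\<^sub>R x + t *\<^sub>R y)) \<le> (1 - t) * F (c + f x) + t * F (c + f y)"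
    using convex_onD[OF assms(2), of t "c + f x" "c + f y"] t xy assms(4) by simp
qed (rule assms)

lemma convex_on_sum_functions:
  assumes "finite I" "convex S" "\<And>i. i \<in> I \<Longrightarrow> convex_on S (f i)"
  shows "convex_on S (\<lambda>x. \<Sum>i\<in>I. f i x)"
  using assms(1,3)
  by (induction I rule: finite_induct) (auto simp: convex_on_const assms(2) intro: convex_on_add)

text \<open>Convexity only ever involves two points at a time. The restriction to a segment is a
  function of one real variable, to which the second derivative test applies.\<close>

lemma convex_on_segments:
  assumes "convex S"
    and "\<And>x y. x \<in> S \<Longrightarrow> y \<in> S \<Longrightarrow> convex_on {0..1} (\<lambda>t::real. f (x + t *\<^sub>R (y - x)))"
  shows "convex_on S f"
proof (rule convex_onI)
  fix t :: real and x y
  assume t: "0 < t" "t < 1" and xy: "x \<in> S" "y \<in> S"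
  have "(1 - t) *\<^sub>R x + t *\<^sub>R y = x + t *\<^sub>R (y - x)"
    by (simp add: algebra_simps)
  then show "f ((1 - t) *\<^sub>R x + t *\<^sub>R y) \<le> (1 - t) * f x + t * f y"
    using convex_onD[OF assms(2)[OF xy], of t 0 1] t by simp
qed (rule assms)

lemma convex_on_minus_ln: "convex_on {0<..} (\<lambda>k. - ln k)"
  using ln_concave by (simp add: concave_on_def)

text \<open>The gap in the convexity inequality is explicit: over the common denominator
  \<open>k * l * n\<close>, where \<open>n\<close> is the interpolated denominator, it equals
  \<open>t * (1 - t) * (a * l - b * k)\<^sup>2\<close>.\<close>

lemma convex_on_square_over_linear:
  "convex_on {(a::real, k). 0 < k} (\<lambda>(a, k). a\<^sup>2 / k)"
proof (rule convex_onI)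
  show "convex {(a::real, k::real). 0 < k}"
    using convex_Times[OF convex_UNIV convex_real_interval(3), of 0]
    by (rule back_subst[where P = convex]) auto
next
  fix t :: real and p q :: "real \<times> real"
  assume t: "0 < t" "t < 1" and "p \<in> {(a, k). 0 < k}" "q \<in> {(a, k). 0 < k}"
  then obtain a k b l where p: "p = (a, k)" "0 < k" and q: "q = (b, l)" "0 < l"
    by auto
  define n where "n = (1 - t) * k + t * l"
  have n: "0 < n"
    unfolding n_def using t p q by (intro add_pos_pos) auto
  have "(1 - t) * (a\<^sup>2 / k) + t * (b\<^sup>2 / l) - ((1 - t) * a + t * b)\<^sup>2 / n
      = t * (1 - t) * (a * l - b * k)\<^sup>2 / (k * l * n)"
  proof -
    have "((1 - t) * a\<^sup>2 * l + t * b\<^sup>2 * k) * n - ((1 - t) * a + t * b)\<^sup>2 * (k * l)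
        = t * (1 - t) * (a * l - b * k)\<^sup>2"
      unfolding n_def by algebra
    then show ?thesis
      using n p q by (simp add: field_simps)
  qed
  also have "\<dots> \<ge> 0"
    using t n p q by simp
  finally show "(case (1 - t) *\<^sub>R p + t *\<^sub>R q of (a, k) \<Rightarrow> a\<^sup>2 / k)
      \<le> (1 - t) * (case p of (a, k) \<Rightarrow> a\<^sup>2 / k) + t * (case q of (a, k) \<Rightarrow> a\<^sup>2 / k)"
    by (simp add: p q n_def)
qed

text \<open>On this set the ratio \<open>a / k\<close> is at most \<open>s\<close> in absolute
  value. Convexity keeps that bound along every segment joining two of its points.\<close>

lemma convex_sector: "convex {(a::real, k::real). 0 < k \<and> \<bar>a\<bar> \<le> s * k}"
proof (rule convexI)
  fix p q :: "real \<times> real" and u v :: real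
  assume pq: "p \<in> {(a, k). 0 < k \<and> \<bar>a\<bar> \<le> s * k}" "q \<in> {(a, k). 0 < k \<and> \<bar>a\<bar> \<le> s * k}"
    and uv: "0 \<le> u" "0 \<le> v" "u + v = 1"
  then obtain a k b l where p: "p = (a, k)" "0 < k" "\<bar>a\<bar> \<le> s * k"
    and q: "q = (b, l)" "0 < l" "\<bar>b\<bar> \<le> s * l"
    by auto
  have "0 < u * k + v * l"
    using uv p q by (cases "u = 0") (auto intro: add_pos_nonneg)
  moreover have "\<bar>u * a + v * b\<bar> \<le> u * \<bar>a\<bar> + v * \<bar>b\<bar>"
    using uv abs_triangle_ineq[of "u * a" "v * b"] by (simp add: abs_mult)
  moreover have "u * \<bar>a\<bar> + v * \<bar>b\<bar> \<le> u * (s * k) + v * (s * l)"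
    using uv p q by (intro add_mono mult_left_mono)
  ultimately show "u *\<^sub>R p + v *\<^sub>R q \<in> {(a, k). 0 < k \<and> \<bar>a\<bar> \<le> s * k}"
    by (simp add: p q algebra_simps)
qed

lemma convex_on_ratio_square_minus_ln:
  "convex_on {(a::real, k::real). 0 < k \<and> \<bar>a\<bar> \<le> s * k} (\<lambda>(a, k). (a / k)\<^sup>2 - 2 * s\<^sup>2 * ln k)"
    (is "convex_on ?T ?F")
proof (rule convex_on_segments)
  show "convex ?T"
    by (rule convex_sector)
next
  fix p q :: "real \<times> real"
  assume pq: "p \<in> ?T" "q \<in> ?T"
  obtain a k where p: "p = (a, k)" by (cases p)
  obtain b l where q: "q = (b, l)" by (cases q)
  define A K r where "A t = a + t * (b - a)" and "K t = k + t * (l - k)" and "r t = A t / K t"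
    for t
  define A' K' where "A' = b - a" and "K' = l - k"
  \<comment> \<open>The quotient rule in this form gives \<open>r' t * K t = A' - r t * K'\<close>.
    As \<open>A'\<close> and \<open>K'\<close> are constant, differentiating once more expresses the
    second derivative of \<open>r\<close> through \<open>r'\<close> alone.\<close>
  define r' where "r' t = (A' - r t * K') / K t" for t
  have in_T: "0 < K t" "\<bar>A t\<bar> \<le> s * K t" if "t \<in> {0..1}" for t
    using convexD_alt[OF convex_sector pq, of t] that
    by (simp_all add: p q A_def K_def algebra_simps)
  have A: "(A has_real_derivative A') (at t)" and K: "(K has_real_derivative K') (at t)" for t
    unfolding A_def K_def A'_def K'_def by (auto intro!: derivative_eq_intros)
  have r: "(r has_real_derivative r' t) (at t)" if "t \<in> {0..1}" for t
    unfolding r_def[abs_def] r'_def using in_T(1)[OF that]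
    by (auto intro!: derivative_eq_intros A K simp: field_simps)
  have r2: "(r' has_real_derivative - 2 * r' t * K' / K t) (at t)" if "t \<in> {0..1}" for t
  proof -
    have "(r' has_real_derivative
        (- (r' t * K') * K t - (A' - r t * K') * K') / (K t * K t)) (at t)"
      unfolding r'_def[abs_def] using in_T(1)[OF that]
      by (auto intro!: derivative_eq_intros K r[OF that, unfolded r'_def])
    moreover have "A' - r t * K' = r' t * K t"
      using in_T(1)[OF that] by (simp add: r'_def)
    ultimately show ?thesis
      using in_T(1)[OF that] by (simp add: field_simps)
  qed
  define f where "f t = (r t)\<^sup>2 - 2 * s\<^sup>2 * ln (K t)" for t
  define f' where "f' t = 2 * r t * r' t - 2 * s\<^sup>2 * K' / K t" for t
  define f'' where
    "f'' t = 2 * (r' t)\<^sup>2 - 4 * r t * r' t * K' / K t + 2 * s\<^sup>2 * (K' / K t)\<^sup>2" for t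
  have "convex_on {0..1} f"
  proof (rule f''_ge0_imp_convex)
    fix t :: real
    assume t: "t \<in> {0..1}"
    show "DERIV f t :> f' t"
      unfolding f_def[abs_def] f'_def using in_T(1)[OF t]
      by (auto intro!: derivative_eq_intros K r[OF t])
    show "DERIV f' t :> f'' t"
      unfolding f'_def[abs_def] f''_def using in_T(1)[OF t]
      by (auto intro!: derivative_eq_intros K r[OF t] r2[OF t]
          simp: field_simps power2_eq_square)
    have "\<bar>r t\<bar> \<le> s"
      using in_T[OF t] by (simp add: r_def field_simps)
    then have "(r t)\<^sup>2 \<le> s\<^sup>2"
      by (simp add: power2_le_iff_abs_le)
    then have "(r t)\<^sup>2 * (K' / K t)\<^sup>2 \<le> s\<^sup>2 * (K' / K t)\<^sup>2"
      by (rule mult_right_mono) simp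
    moreover have "0 \<le> (r' t - r t * (K' / K t))\<^sup>2"
      by simp
    \<comment> \<open>Completing the square costs
      \<open>2 * (r t)\<^sup>2 * (K' / K t)\<^sup>2\<close>, which the logarithm covers because
      \<open>(r t)\<^sup>2 \<le> s\<^sup>2\<close>. This is where the factor 2 in front of
      \<open>M\<close> comes from.\<close>
    moreover have "f'' t = 2 * (r' t - r t * (K' / K t))\<^sup>2
        + 2 * (s\<^sup>2 * (K' / K t)\<^sup>2 - (r t)\<^sup>2 * (K' / K t)\<^sup>2)"
      by (simp add: f''_def power2_eq_square algebra_simps)
    ultimately show "0 \<le> f'' t"
      by simp
  qed (simp add: convex_real_interval)
  then show "convex_on {0..1} (\<lambda>t. ?F (p + t *\<^sub>R (q - p)))"
    by (simp add: p q f_def[abs_def] r_def A_def K_def)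
qed

section \<open>Losses and marginals under a common conditional\<close>

text \<open>Points outside the support contribute 0. The index set, which depends on the measure and
  hence on \<open>z\<close>, can thus be traded for a fixed one, so that losses can be compared and
  shown convex term by term.\<close>

lemma expected_loss_eq_sum:
  fixes \<mu> :: "'x::finite \<times> real \<Rightarrow> real"
  assumes "\<And>x. finite (T x)" "\<And>x y. \<mu> (x, y) \<noteq> 0 \<Longrightarrow> y \<in> T x"
  shows "expected_loss \<mu> g = (\<Sum>x\<in>UNIV. \<Sum>y\<in>T x. \<mu> (x, y) * (g x - y)\<^sup>2)"
proof -
  have "expected_loss \<mu> g = (\<Sum>(x, y)\<in>Sigma UNIV T. \<mu> (x, y) * squared_loss (g x) y)"
    unfolding expected_loss_def
    by (rule sum.mono_neutral_left) (use assms in auto)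
  also have "\<dots> = (\<Sum>x\<in>UNIV. \<Sum>y\<in>T x. \<mu> (x, y) * (g x - y)\<^sup>2)"
    using assms(1) by (simp add: sum.Sigma squared_loss_def)
  finally show ?thesis .
qed

lemma marginal_eq_sum:
  assumes "finite T" "\<And>y. \<mu> (x, y) \<noteq> 0 \<Longrightarrow> y \<in> T"
  shows "marginal \<mu> x = (\<Sum>y\<in>T. \<mu> (x, y))"
  unfolding marginal_def by (rule sum.mono_neutral_left) (use assms in auto)

lemma marginal_nonneg: "0 \<le> marginal (pmf P) x"
  by (simp add: marginal_def sum_nonneg)

lemma mixture_common_conditional:
  assumes "common_conditional Y D C"
  shows "mixture D z (x, y) = (\<Sum>k\<in>UNIV. z $ k * marginal (pmf (D k)) x) * pmf (C x) y"
proof -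
  have "pmf (D k) (x, y) = marginal (pmf (D k)) x * pmf (C x) y" for k
    using assms by (simp add: common_conditional_def)
  then show ?thesis
    by (simp only: mixture_def sum_distrib_right mult.assoc)
qed

text \<open>The mixture factors through \<open>C x\<close>, whose masses sum to 1. The marginal is
  therefore linear in \<open>z\<close>, which makes \<open>K_fun\<close> affine.\<close>

lemma marginal_mixture:
  assumes "common_conditional Y D C"
  shows "marginal (mixture D z) x = (\<Sum>k\<in>UNIV. z $ k * marginal (pmf (D k)) x)"
proof -
  have fin: "finite (set_pmf (C x))"
    using assms by (simp add: common_conditional_def finite_dist_on_def)
  have "marginal (mixture D z) x = (\<Sum>y\<in>set_pmf (C x). mixture D z (x, y))"
    by (rule marginal_eq_sum[OF fin])
       (auto simp: mixture_common_conditional[OF assms] set_pmf_iff)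
  also have "\<dots> = (\<Sum>k\<in>UNIV. z $ k * marginal (pmf (D k)) x)"
    by (simp add: mixture_common_conditional[OF assms] sum_pmf_eq_1[OF fin]
        flip: sum_distrib_left)
  finally show ?thesis .
qed

lemma convex_prob_simplex: "convex prob_simplex"
proof (rule convexI)
  fix z w :: "real ^ 'p::finite" and u v :: real
  assume zw: "z \<in> prob_simplex" "w \<in> prob_simplex" and uv: "0 \<le> u" "0 \<le> v" "u + v = 1"
  have "(\<Sum>k\<in>UNIV. (u *\<^sub>R z + v *\<^sub>R w) $ k)
      = u * (\<Sum>k\<in>UNIV. z $ k) + v * (\<Sum>k\<in>UNIV. w $ k)"
    by (simp add: sum.distrib sum_distrib_left)
  then show "u *\<^sub>R z + v *\<^sub>R w \<in> prob_simplex"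
    using zw uv by (simp add: prob_simplex_def)
qed

lemma linear_weighted_sum: "linear (\<lambda>z::real ^ 'p::finite. \<Sum>k\<in>UNIV. z $ k * a k)"
  by (rule linearI) (simp_all add: sum.distrib sum_distrib_left algebra_simps)

theorem proposition8:
  fixes Y :: "real set"
    and D :: "'p::finite \<Rightarrow> ('x::finite \<times> real) pmf"
    and C :: "'x \<Rightarrow> real pmf"
    and h :: "'p \<Rightarrow> 'x \<Rightarrow> real"
    and \<eta> M :: real
  assumes "Y \<noteq> {}" and "convex Y"
    and "\<And>k. finite_dist_on (UNIV \<times> Y) (D k)"
    and "\<And>k x. h k x \<in> Y"
    and "\<eta> > 0"
    and "\<And>k x y. y \<in> Y \<Longrightarrow> squared_loss (h k x) y \<le> M"
    and "common_conditional Y D C"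
  shows "\<forall>k. (\<forall>z\<in>prob_simplex.
             expected_loss (pmf (D k)) (h_comb D h \<eta> z) - expected_loss (mixture D z) (h_comb D h \<eta> z)
               = u_fun D C h \<eta> M k z - v_fun D C h \<eta> M k z)
         \<and> convex_on prob_simplex (u_fun D C h \<eta> M k)
         \<and> convex_on prob_simplex (v_fun D C h \<eta> M k)"
proof -
  define d where "d k = marginal (pmf (D k))" for k
  \<comment> \<open>The uniform mass is the same at every input, so an arbitrary input may stand for
    all.\<close>
  define m where "m = \<eta> * pmf (unif :: 'x pmf) undefined"
  have m: "\<eta> * pmf unif x = m" for x :: 'x
    by (simp add: m_def unif_def)
  have m_pos: "0 < m"
    using assms(5) by (simp add: m_def unif_def)
  have d_nonneg: "0 \<le> d k x" for k x
    by (simp add: d_def marginal_nonneg)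
  have fin: "finite (set_pmf (C x))" and sub: "set_pmf (C x) \<subseteq> Y" for x
    using assms(7) by (simp_all add: common_conditional_def finite_dist_on_def)
  have D: "pmf (D k) (x, y) = d k x * pmf (C x) y" for k x y
    using assms(7) by (simp add: common_conditional_def d_def)

  define s where "s = sqrt M"
  have "0 \<le> M"
    \<comment> \<open>A predicted value lies in \<open>Y\<close>; taken as the label, it has loss 0,
      and the bound reads \<open>0 \<le> M\<close>.\<close>
    using assms(6)[OF assms(4), of undefined undefined undefined undefined]
    by (simp add: squared_loss_def)
  then have M: "M = s\<^sup>2"
    by (simp add: s_def)
  have h_bound: "\<bar>h k x - y\<bar> \<le> s" if "y \<in> set_pmf (C x)" for k x y
  proof -
    have "(h k x - y)\<^sup>2 \<le> M"
      using assms(6)[of y k x] sub that by (auto simp: squared_loss_def)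
    then show ?thesis
      unfolding s_def using real_sqrt_le_mono[of "(h k x - y)\<^sup>2" M] by simp
  qed

  \<comment> \<open>The prediction error as a ratio of affine functions of the weights\<close>
  define W where "W z k x = z $ k * d k x + m / real CARD('p)" for z :: "real ^ 'p" and k x
  define K where "K z x = (\<Sum>k\<in>UNIV. W z k x)" for z x
  define A where "A z x y = (\<Sum>k\<in>UNIV. W z k x * (h k x - y))" for z x y
  define H where "H z = h_comb D h \<eta> z" for z
  \<comment> \<open>Each source receives the same share of \<open>m\<close>, and these shares add up
    to \<open>m\<close>. So \<open>K\<close> is both the total weight and the denominator in
    \<open>h_comb\<close>, and \<open>h_comb\<close> is a weighted mean; this is what allows
    \<open>y\<close> to be subtracted inside the sum defining \<open>A\<close>.\<close>
  have K_eq: "K z x = (\<Sum>k\<in>UNIV. z $ k * d k x) + m" for z x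
    by (simp add: K_def W_def sum.distrib)
  have K_fun: "K_fun D \<eta> z x = K z x" for z x
    by (simp add: K_fun_def marginal_mixture[OF assms(7)] K_eq m d_def)
  have W_nonneg: "0 \<le> W z k x" if "z \<in> prob_simplex" for z k x
    using that d_nonneg m_pos by (simp add: W_def prob_simplex_def)
  have K_pos: "0 < K z x" if "z \<in> prob_simplex" for z x
    using that d_nonneg m_pos
    by (auto simp: K_eq prob_simplex_def intro!: add_nonneg_pos sum_nonneg)
  have A_bound: "\<bar>A z x y\<bar> \<le> s * K z x"
    if "z \<in> prob_simplex" "y \<in> set_pmf (C x)" for z x y
  proof -
    have "\<bar>A z x y\<bar> \<le> (\<Sum>k\<in>UNIV. \<bar>W z k x * (h k x - y)\<bar>)"
      unfolding A_def by (rule sum_abs)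
    also have "\<dots> \<le> (\<Sum>k\<in>UNIV. W z k x * s)"
      using W_nonneg[OF that(1)] h_bound[OF that(2)]
      by (intro sum_mono) (simp add: abs_mult mult_left_mono)
    finally show ?thesis
      by (simp add: K_def sum_distrib_left mult.commute)
  qed
  have H: "H z x - y = A z x y / K z x" if "z \<in> prob_simplex" for z x y
  proof -
    have "H z x = (\<Sum>k\<in>UNIV. W z k x * h k x) / K z x"
      by (simp add: H_def h_comb_def K_fun m W_def d_def sum_divide_distrib)
    moreover have "A z x y = (\<Sum>k\<in>UNIV. W z k x * h k x) - y * K z x"
      by (simp add: A_def K_def right_diff_distrib sum_subtractf sum_distrib_left mult.commute)
    ultimately show ?thesis
      using K_pos[OF that, of x] by (simp add: field_simps)
  qed

  \<comment> \<open>The four losses over the supports of the kernel\<close>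
  have loss_D: "expected_loss (pmf (D k)) g
      = (\<Sum>x\<in>UNIV. \<Sum>y\<in>set_pmf (C x). d k x * pmf (C x) y * (g x - y)\<^sup>2)" for k g
    by (subst expected_loss_eq_sum[OF fin]) (auto simp: D set_pmf_iff)
  have loss_mix: "expected_loss (mixture D z) g
      = (\<Sum>x\<in>UNIV. \<Sum>y\<in>set_pmf (C x). (K z x - m) * pmf (C x) y * (g x - y)\<^sup>2)" for z g
    by (subst expected_loss_eq_sum[OF fin])
       (auto simp: mixture_common_conditional[OF assms(7)] K_eq d_def set_pmf_iff)
  have loss_D': "expected_loss (\<lambda>q. pmf (D k) q + \<eta> * unif_cond C q) g
      = (\<Sum>x\<in>UNIV. \<Sum>y\<in>set_pmf (C x). (d k x + m) * pmf (C x) y * (g x - y)\<^sup>2)" for k g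
    by (subst expected_loss_eq_sum[OF fin])
       (auto simp: D unif_cond_def set_pmf_iff distrib_right m simp flip: mult.assoc)
  \<comment> \<open>The uniform term raises the mixture marginal \<open>K z x - m\<close> to exactly
    \<open>K z x\<close>, which later cancels one factor of the denominator in the squared
    error.\<close>
  have loss_mix': "expected_loss (\<lambda>q. mixture D z q + \<eta> * unif_cond C q) g
      = (\<Sum>x\<in>UNIV. \<Sum>y\<in>set_pmf (C x). K z x * pmf (C x) y * (g x - y)\<^sup>2)" for z g
    by (subst expected_loss_eq_sum[OF fin])
       (auto simp: mixture_common_conditional[OF assms(7)] K_eq d_def unif_cond_def set_pmf_iff
         distrib_right m simp flip: mult.assoc)

  \<comment> \<open>Convexity of the summands in the weights\<close>
  define lin where "lin x y = (\<lambda>z :: real ^ 'p.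
      (\<Sum>k\<in>UNIV. z $ k * (d k x * (h k x - y)), \<Sum>k\<in>UNIV. z $ k * d k x))" for x y
  define cst where "cst x y = (\<Sum>k\<in>UNIV. m / real CARD('p) * (h k x - y), m)" for x y
  have lin: "linear (lin x y)" for x y
    unfolding lin_def
    by (rule linearI) (simp_all add: distrib_right sum.distrib sum_distrib_left mult.assoc)
  have AK: "cst x y + lin x y z = (A z x y, K z x)" for x y z
    by (simp add: cst_def lin_def A_def K_eq W_def distrib_right sum.distrib mult.assoc)

  \<comment> \<open>For labels in the support, \<open>A_bound\<close> puts the pair
    \<open>(A z x y, K z x)\<close> into the sector with slope \<open>s = sqrt M\<close>.\<close>
  have cvx_u: "convex_on prob_simplex (\<lambda>z. (A z x y / K z x)\<^sup>2 - 2 * M * ln (K z x))"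
    if "y \<in> set_pmf (C x)" for x y
    using convex_on_compose_affine[OF lin convex_on_ratio_square_minus_ln[of s]
        convex_prob_simplex, of "cst x y" x y] K_pos A_bound that
    by (simp add: AK M)
  have cvx_ln: "convex_on prob_simplex (\<lambda>z. - ln (K z x))" for x
    using convex_on_compose_affine[OF linear_weighted_sum convex_on_minus_ln
        convex_prob_simplex, of m "\<lambda>k. d k x"] K_pos
    by (simp add: K_eq add.commute)
  have cvx_v: "convex_on prob_simplex (\<lambda>z. (A z x y)\<^sup>2 / K z x)" for x y
    using convex_on_compose_affine[OF lin convex_on_square_over_linear
        convex_prob_simplex, of "cst x y" x y] K_pos
    by (simp add: AK)

  \<comment> \<open>The decomposition and the convexity of both parts\<close>
  show ?thesis
  proof (intro allI conjI ballI)
    fix k and z :: "real ^ 'p"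
    show "expected_loss (pmf (D k)) (h_comb D h \<eta> z) - expected_loss (mixture D z) (h_comb D h \<eta> z)
        = u_fun D C h \<eta> M k z - v_fun D C h \<eta> M k z"
      \<comment> \<open>The logarithmic sums cancel, and the coefficients agree termwise:
        \<open>(d k x + m) - K z x = d k x - (K z x - m)\<close>.\<close>
      by (simp add: u_fun_def v_fun_def loss_D loss_mix loss_D' loss_mix' algebra_simps
          flip: sum_subtractf)
  next
    fix k
    have "u_fun D C h \<eta> M k z = (\<Sum>x\<in>UNIV. \<Sum>y\<in>set_pmf (C x).
        (d k x + m) * pmf (C x) y * ((A z x y / K z x)\<^sup>2 - 2 * M * ln (K z x)))"
      if "z \<in> prob_simplex" for z
    proof -
      \<comment> \<open>As the masses of \<open>C x\<close> sum to 1, the logarithm can be spread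
        over the labels, so that every squared ratio is paired with the logarithm that makes it
        convex.\<close>
      have "(\<Sum>y\<in>set_pmf (C x). a * pmf (C x) y * b) = a * b" for x and a b :: real
        by (simp add: sum_pmf_eq_1[OF fin] flip: sum_distrib_left sum_distrib_right)
      then show ?thesis
        unfolding u_fun_def loss_D' K_fun m d_def[symmetric] H_def[symmetric] H[OF that]
        by (simp only: right_diff_distrib sum_subtractf) (simp add: sum_distrib_left distrib_left mult_ac)
    qed
    moreover have "convex_on prob_simplex (\<lambda>z. \<Sum>x\<in>UNIV. \<Sum>y\<in>set_pmf (C x).
        (d k x + m) * pmf (C x) y * ((A z x y / K z x)\<^sup>2 - 2 * M * ln (K z x)))"
      using d_nonneg m_pos
      by (intro convex_on_sum_functions convex_prob_simplex fin convex_on_cmul cvx_u)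
         (auto intro!: mult_nonneg_nonneg add_nonneg_nonneg)
    \<comment> \<open>The formula for \<open>u_fun\<close> was derived on the simplex only;
      convexity carries over because convex combinations of its points stay inside.\<close>
    ultimately show "convex_on prob_simplex (u_fun D C h \<eta> M k)"
      using convex_prob_simplex by (simp add: convex_on_def convex_def)
  next
    fix k
    have "v_fun D C h \<eta> M k z = (\<Sum>x\<in>UNIV. \<Sum>y\<in>set_pmf (C x). pmf (C x) y * ((A z x y)\<^sup>2 / K z x))
        + (\<Sum>x\<in>UNIV. 2 * M * (d k x + m) * (- ln (K z x)))"
      if "z \<in> prob_simplex" for z
    proof -
      \<comment> \<open>After this cancellation the quadratic term is convex by itself, so the
        logarithm can stay in a separate sum.\<close>
      have "K z x * pmf (C x) y * (A z x y / K z x)\<^sup>2 = pmf (C x) y * ((A z x y)\<^sup>2 / K z x)" for x y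
        using K_pos[OF that, of x] by (simp add: field_simps power2_eq_square)
      then show ?thesis
        unfolding v_fun_def loss_mix' K_fun m d_def[symmetric] H_def[symmetric] H[OF that]
        by (simp add: sum_distrib_left sum_negf mult_ac)
    qed
    moreover have "convex_on prob_simplex (\<lambda>z.
        (\<Sum>x\<in>UNIV. \<Sum>y\<in>set_pmf (C x). pmf (C x) y * ((A z x y)\<^sup>2 / K z x))
        + (\<Sum>x\<in>UNIV. 2 * M * (d k x + m) * (- ln (K z x))))"
      using d_nonneg m_pos \<open>0 \<le> M\<close>
      by (intro convex_on_add convex_on_sum_functions convex_prob_simplex fin convex_on_cmul
          cvx_v cvx_ln)
         (auto intro!: mult_nonneg_nonneg add_nonneg_nonneg)
    ultimately show "convex_on prob_simplex (v_fun D C h \<eta> M k)"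
      using convex_prob_simplex by (simp add: convex_on_def convex_def)
  qed
qed

end
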